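(* Let $\Gamma$ and $\Delta$ be controllable graphs. Then $\Gamma$ and $\Delta$ are isomorphic if and only if they are $C^2$-equivalent.
   Context: All graphs are finite, undirected, without loops or multiple edges. The adjacency matrix $A$ of a graph $\Gamma=(X,E)$ is the $0/1$ matrix indexed by $X$ with $A_{xy}=1$ if and only if $x$ and $y$ are adjacent. The walk matrix of a graph $\Gamma$ with $n$ vertices and adjacency matrix $A$ is the $n\times n$ matrix $W_\Gamma=[\mathbf{1}\;\; A\mathbf{1}\;\;\cdots\;\; A^{n-1}\mathbf{1}]$, where $\mathbf{1}$ is the all-one vector. The graph $\Gamma$ is controllable if $W_\Gamma$ is invertible. Logic: the language of graphs has one binary relation symbol $E$, interpreted as adjacency, and variables range over the vertices. For a positive integer $k$, $C^k$ denotes the fragment of first-order logic (with equality) in which only $k$ distinct variables may be used (variables may be re-quantified), with the usual connectives and quantifiers and, in addition, a counting quantifier $\exists^{\geq i}$ for each positive integer $i$; $\exists^{\geq i}x\,\varphi$ is true if there are at least $i$ distinct vertices that can be substituted for $x$ to make $\varphi$ true. Two graphs $\Gamma$ and $\Delta$ are $C^k$-equivalent if they satisfy exactly the same $C^k$-sentences. *)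

theory Defs
  imports
    "Graph_Theory.Graph_Theory"
    "Jordan_Normal_Form.Determinant"
begin

text \<open>
  Graphs are those of the locale \<^locale>\<open>graph\<close>: finite symmetric digraphs without loops or
  parallel arcs, so that an edge is a pair of opposite arcs. The graph without vertices is allowed.
\<close>

text \<open>
  The rows and columns of a \<^typ>\<open>'a mat\<close> are numbered, so the matrices below depend on an
  enumeration \<open>vs\<close> of the vertices. Lemma \<open>controllable_iff\<close> shows that controllability does not.
\<close>

definition adj_mat :: "('a, 'b) pre_digraph \<Rightarrow> 'a list \<Rightarrow> real mat" where
  "adj_mat G vs = mat (length vs) (length vs)
     (\<lambda>(i, j). if vs ! i \<rightarrow>\<^bsub>G\<^esub> vs ! j then 1 else 0)"

definition walk_mat :: "('a, 'b) pre_digraph \<Rightarrow> 'a list \<Rightarrow> real mat" where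
  "walk_mat G vs = (let n = length vs in
     mat_of_cols n (map (\<lambda>k. (adj_mat G vs ^\<^sub>m k) *\<^sub>v vec n (\<lambda>_. 1)) [0..<n]))"

definition controllable :: "('a, 'b) pre_digraph \<Rightarrow> bool" where
  "controllable G \<longleftrightarrow>
     (\<exists>vs. distinct vs \<and> set vs = verts G \<and> invertible_mat (walk_mat G vs))"

fun num_walks :: "('a, 'b) pre_digraph \<Rightarrow> nat \<Rightarrow> 'a \<Rightarrow> real" where
  "num_walks G 0 x = 1"
| "num_walks G (Suc k) x = (\<Sum>y\<in>verts G. (if x \<rightarrow>\<^bsub>G\<^esub> y then 1 else 0) * num_walks G k y)"

lemma adj_mat_carrier [simp]: "adj_mat G vs \<in> carrier_mat (length vs) (length vs)"
  by (simp add: adj_mat_def)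

lemma pow_mat_Suc_left:
  fixes A :: "'a :: semiring_1 mat"
  assumes A: "A \<in> carrier_mat n n"
  shows "A ^\<^sub>m Suc k = A * A ^\<^sub>m k"
proof (induction k)
  case 0
  show ?case using A by simp
next
  case (Suc k)
  have "A ^\<^sub>m Suc (Suc k) = (A * A ^\<^sub>m k) * A" using Suc by simp
  also have "\<dots> = A * A ^\<^sub>m Suc k"
    using assoc_mult_mat[OF A pow_carrier_mat[OF A] A] by simp
  finally show ?case .
qed

lemma adj_mat_pow_ones:
  assumes "distinct vs" "set vs = verts G"
  shows "(adj_mat G vs ^\<^sub>m k) *\<^sub>v vec (length vs) (\<lambda>_. 1)
    = vec (length vs) (\<lambda>i. num_walks G k (vs ! i))"
proof (induction k)
  case 0
  show ?case by (simp add: adj_mat_def)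
next
  case (Suc k)
  let ?n = "length vs" and ?A = "adj_mat G vs"
  have bij: "bij_betw ((!) vs) {0..<?n} (verts G)"
    using assms bij_betw_nth[of vs "{0..<?n}" "verts G"] by (simp add: atLeast0LessThan)
  have "(?A ^\<^sub>m Suc k) *\<^sub>v vec ?n (\<lambda>_. 1) = (?A * ?A ^\<^sub>m k) *\<^sub>v vec ?n (\<lambda>_. 1)"
    using pow_mat_Suc_left[OF adj_mat_carrier] by metis
  also have "\<dots> = ?A *\<^sub>v (?A ^\<^sub>m k *\<^sub>v vec ?n (\<lambda>_. 1))"
    by (rule assoc_mult_mat_vec[of _ ?n ?n _ ?n]) (auto intro: pow_carrier_mat)
  also have "\<dots> = ?A *\<^sub>v vec ?n (\<lambda>i. num_walks G k (vs ! i))"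
    by (simp only: Suc)
  also have "\<dots> = vec ?n (\<lambda>i. num_walks G (Suc k) (vs ! i))"
  proof (rule eq_vecI)
    fix i assume "i < dim_vec (vec ?n (\<lambda>i. num_walks G (Suc k) (vs ! i)))"
    then have i: "i < ?n" by simp
    have "(?A *\<^sub>v vec ?n (\<lambda>i. num_walks G k (vs ! i))) $ i
      = (\<Sum>j = 0..<?n. (if vs ! i \<rightarrow>\<^bsub>G\<^esub> vs ! j then 1 else 0) * num_walks G k (vs ! j))"
      using i by (simp add: adj_mat_def scalar_prod_def)
    also have "\<dots> = num_walks G (Suc k) (vs ! i)"
      using sum.reindex_bij_betw[OF bij,
          of "\<lambda>y. (if vs ! i \<rightarrow>\<^bsub>G\<^esub> y then 1 else 0) * num_walks G k y"]
      by simp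
    finally show "(?A *\<^sub>v vec ?n (\<lambda>i. num_walks G k (vs ! i))) $ i
      = vec ?n (\<lambda>i. num_walks G (Suc k) (vs ! i)) $ i" using i by simp
  qed (simp add: adj_mat_def)
  finally show ?case .
qed

lemma walk_mat_eq:
  assumes "distinct vs" "set vs = verts G"
  shows "walk_mat G vs = mat (length vs) (length vs) (\<lambda>(i, k). num_walks G k (vs ! i))"
  by (rule eq_matI)
    (auto simp: walk_mat_def Let_def adj_mat_pow_ones[OF assms] mat_of_cols_index)

lemma invertible_mat_iff_det:
  fixes A :: "'a :: field mat"
  assumes A: "A \<in> carrier_mat n n"
  shows "invertible_mat A \<longleftrightarrow> det A \<noteq> 0"
proof
  assume "invertible_mat A"
  then obtain B where B: "A * B = 1\<^sub>m n" "B * A = 1\<^sub>m (dim_row B)"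
    using A unfolding invertible_mat_def inverts_mat_def by auto
  have "dim_col B = n" using arg_cong[OF B(1), of dim_col] by simp
  moreover have "dim_row B = n" using arg_cong[OF B(2), of dim_col] A by simp
  ultimately have "B \<in> carrier_mat n n" by auto
  then have "det A * det B = 1" using det_mult[OF A, of B] B(1) by simp
  then show "det A \<noteq> 0" by auto
next
  assume "det A \<noteq> 0"
  then obtain B where "B \<in> carrier_mat n n" "B * A = 1\<^sub>m n" "A * B = 1\<^sub>m n"
    using det_non_zero_imp_unit[OF A, of undefined]
    unfolding Units_def ring_mat_def by auto
  then show "invertible_mat A"
    using A unfolding invertible_mat_def inverts_mat_def by (auto intro!: exI[of _ B])
qed

lemma det_walk_mat_reorder:
  assumes vs: "distinct vs" "set vs = verts G" and ws: "distinct ws" "set ws = verts G"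
    and nz: "det (walk_mat G vs) \<noteq> 0"
  shows "det (walk_mat G ws) \<noteq> 0"
proof -
  let ?n = "length vs"
  have len: "length ws = ?n" using vs ws by (metis distinct_card)
  have "mset ws = mset vs" using set_eq_iff_mset_eq_distinct[OF ws(1) vs(1)] vs(2) ws(2) by simp
  then obtain p where p: "p permutes {..<?n}" and ws_eq: "permute_list p vs = ws"
    by (rule mset_eq_permutation)
  have p': "p permutes {0..<?n}" using p by (simp add: atLeast0LessThan)
  have "walk_mat G ws = mat ?n ?n (\<lambda>(i, k). walk_mat G vs $$ (p i, k))"
    unfolding walk_mat_eq[OF vs] walk_mat_eq[OF ws] len
    using permutes_in_image[OF p] by (intro eq_matI) (auto simp: permute_list_nth p ws_eq[symmetric])
  then have "det (walk_mat G ws) = signof p * det (walk_mat G vs)"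
    using det_permute_rows[OF _ p', of "walk_mat G vs"] by (simp add: walk_mat_eq[OF vs])
  then show ?thesis using nz by (auto simp: sign_def)
qed

lemma controllable_iff:
  assumes vs: "distinct vs" "set vs = verts G"
  shows "controllable G \<longleftrightarrow> invertible_mat (walk_mat G vs)"
proof -
  have "invertible_mat (walk_mat G us) \<longleftrightarrow> det (walk_mat G us) \<noteq> 0"
    if "distinct us" "set us = verts G" for us
    using invertible_mat_iff_det[of "walk_mat G us" "length us"] by (simp add: walk_mat_eq[OF that])
  then show ?thesis
    unfolding controllable_def using vs det_walk_mat_reorder by metis
qed

text \<open>
  \<^term>\<open>fm_vars\<close> collects every variable written in a formula, including a variable that only
  appears next to a quantifier.
\<close>

datatype (fm_vars: 'v) fm =
    Equal 'v 'v
  | Edge 'v 'v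
  | Falsum
  | Neg "'v fm"
  | Conj "'v fm" "'v fm"
  | Disj "'v fm" "'v fm"
  | Impl "'v fm" "'v fm"
  | Equiv "'v fm" "'v fm"
  | Forall 'v "'v fm"
  | Exists 'v "'v fm"
  | ExistsGE nat 'v "'v fm"

primrec free_vars :: "'v fm \<Rightarrow> 'v set" where
  "free_vars (Equal x y) = {x, y}"
| "free_vars (Edge x y) = {x, y}"
| "free_vars Falsum = {}"
| "free_vars (Neg p) = free_vars p"
| "free_vars (Conj p q) = free_vars p \<union> free_vars q"
| "free_vars (Disj p q) = free_vars p \<union> free_vars q"
| "free_vars (Impl p q) = free_vars p \<union> free_vars q"
| "free_vars (Equiv p q) = free_vars p \<union> free_vars q"
| "free_vars (Forall x p) = free_vars p - {x}"
| "free_vars (Exists x p) = free_vars p - {x}"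
| "free_vars (ExistsGE i x p) = free_vars p - {x}"

primrec positive_counts :: "'v fm \<Rightarrow> bool" where
  "positive_counts (Equal x y) = True"
| "positive_counts (Edge x y) = True"
| "positive_counts Falsum = True"
| "positive_counts (Neg p) = positive_counts p"
| "positive_counts (Conj p q) = (positive_counts p \<and> positive_counts q)"
| "positive_counts (Disj p q) = (positive_counts p \<and> positive_counts q)"
| "positive_counts (Impl p q) = (positive_counts p \<and> positive_counts q)"
| "positive_counts (Equiv p q) = (positive_counts p \<and> positive_counts q)"
| "positive_counts (Forall x p) = positive_counts p"
| "positive_counts (Exists x p) = positive_counts p"
| "positive_counts (ExistsGE i x p) = (i > 0 \<and> positive_counts p)"

primrec sat :: "('a, 'b) pre_digraph \<Rightarrow> ('v \<Rightarrow> 'a) \<Rightarrow> 'v fm \<Rightarrow> bool" where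
  "sat G s (Equal x y) \<longleftrightarrow> s x = s y"
| "sat G s (Edge x y) \<longleftrightarrow> s x \<rightarrow>\<^bsub>G\<^esub> s y"
| "sat G s Falsum \<longleftrightarrow> False"
| "sat G s (Neg p) \<longleftrightarrow> \<not> sat G s p"
| "sat G s (Conj p q) \<longleftrightarrow> sat G s p \<and> sat G s q"
| "sat G s (Disj p q) \<longleftrightarrow> sat G s p \<or> sat G s q"
| "sat G s (Impl p q) \<longleftrightarrow> (sat G s p \<longrightarrow> sat G s q)"
| "sat G s (Equiv p q) \<longleftrightarrow> (sat G s p \<longleftrightarrow> sat G s q)"
| "sat G s (Forall x p) \<longleftrightarrow> (\<forall>v\<in>verts G. sat G (s(x := v)) p)"
| "sat G s (Exists x p) \<longleftrightarrow> (\<exists>v\<in>verts G. sat G (s(x := v)) p)"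
| "sat G s (ExistsGE i x p) \<longleftrightarrow> card {v \<in> verts G. sat G (s(x := v)) p} \<ge> i"

lemma sat_cong:
  "(\<And>x. x \<in> free_vars p \<Longrightarrow> s x = t x) \<Longrightarrow> sat G s p \<longleftrightarrow> sat G t p"
proof (induction p arbitrary: s t)
  case (Forall x p)
  have "sat G (s(x := v)) p \<longleftrightarrow> sat G (t(x := v)) p" for v
    using Forall.prems by (intro Forall.IH) auto
  then show ?case by simp
next
  case (Exists x p)
  have "sat G (s(x := v)) p \<longleftrightarrow> sat G (t(x := v)) p" for v
    using Exists.prems by (intro Exists.IH) auto
  then show ?case by simp
next
  case (ExistsGE i x p)
  have "sat G (s(x := v)) p \<longleftrightarrow> sat G (t(x := v)) p" for v
    using ExistsGE.prems by (intro ExistsGE.IH) auto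
  then show ?case by simp
next
  case (Neg p)
  then show ?case unfolding sat.simps free_vars.simps by blast
next
  case (Conj p q)
  then show ?case unfolding sat.simps free_vars.simps by (metis UnCI)
next
  case (Disj p q)
  then show ?case unfolding sat.simps free_vars.simps by (metis UnCI)
next
  case (Impl p q)
  then show ?case unfolding sat.simps free_vars.simps by (metis UnCI)
next
  case (Equiv p q)
  then show ?case unfolding sat.simps free_vars.simps by (metis UnCI)
qed auto

definition C_sentences :: "nat \<Rightarrow> nat fm set" where
  "C_sentences k = {p. card (fm_vars p) \<le> k \<and> positive_counts p \<and> free_vars p = {}}"

text \<open>
  The truth value of a sentence does not depend on the assignment (\<open>sat_cong\<close>). Assignments are not
  required to take values in \<^term>\<open>verts G\<close>, so there is always one, even for the graph without
  vertices.
\<close>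

definition models :: "('a, 'b) pre_digraph \<Rightarrow> nat fm \<Rightarrow> bool" where
  "models G p \<longleftrightarrow> (\<forall>s. sat G s p)"

definition C_equivalent :: "nat \<Rightarrow> ('a, 'b) pre_digraph \<Rightarrow> ('c, 'd) pre_digraph \<Rightarrow> bool" where
  "C_equivalent k G H \<longleftrightarrow> (\<forall>p\<in>C_sentences k. models G p \<longleftrightarrow> models H p)"

end

theory Submission
  imports Defs
begin

text \<open>
  The number of walks of length \<open>k\<close> starting at a vertex is expressible with two variables: a walk
  of length \<open>k + 1\<close> starts with a step to a neighbour, and one counts the neighbours according to the
  number of walks of length \<open>k\<close> from them, reusing the variable of the original vertex. So
  \<open>C\<^sup>2\<close>-equivalent graphs have the same rows of walk counts \<open>w\<^sub>0(x), \<dots>, w\<^sub>K(x)\<close> for every \<open>K\<close>. The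
  rows of an invertible walk matrix are distinct, so in the controllable case matching equal rows
  gives a bijection of the vertices. Numbering the vertices along it, both graphs have the same walk
  matrix \<open>W\<close>, and \<open>A W\<close>, which consists of walk counts too, is also the same for both adjacency
  matrices \<open>A\<close>; hence the adjacency matrices agree.
\<close>

section \<open>Isomorphisms as bijections of the vertices\<close>

text \<open>Without parallel arcs an arc is determined by its ends, so a vertex map dictates the arc
  map. In \<open>G\<close> this makes \<open>g\<close> injective, in \<open>H\<close>
  surjective.\<close>

lemma digraph_isoI_bij:
  assumes "nomulti_digraph G" "nomulti_digraph H"
    and bij: "bij_betw f (verts G) (verts H)"
    and adj: "\<And>u v. \<lbrakk>u \<in> verts G; v \<in> verts G\<rbrakk> \<Longrightarrow> u \<rightarrow>\<^bsub>G\<^esub> v \<longleftrightarrow> f u \<rightarrow>\<^bsub>H\<^esub> f v"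
  shows "digraph_iso G H"
proof -
  interpret G: nomulti_digraph G by fact
  interpret H: nomulti_digraph H by fact
  have inj: "inj_on f (verts G)" and im: "f ` verts G = verts H"
    using bij by (auto simp: bij_betw_def)
  have "\<exists>b\<in>arcs H. tail H b = f (tail G a) \<and> head H b = f (head G a)" if "a \<in> arcs G" for a
  proof -
    have "tail G a \<rightarrow>\<^bsub>G\<^esub> head G a" using that by (auto simp: arcs_ends_conv)
    then have "f (tail G a) \<rightarrow>\<^bsub>H\<^esub> f (head G a)" using that adj by simp
    then show ?thesis by (auto simp: arcs_ends_conv)
  qed
  then obtain g where g: "\<And>a. a \<in> arcs G \<Longrightarrow> g a \<in> arcs H"
      "\<And>a. a \<in> arcs G \<Longrightarrow> tail H (g a) = f (tail G a)"
      "\<And>a. a \<in> arcs G \<Longrightarrow> head H (g a) = f (head G a)"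
    by metis
  have "inj_on g (arcs G)"
  proof (rule inj_onI)
    fix a b assume ab: "a \<in> arcs G" "b \<in> arcs G" "g a = g b"
    have "tail G a = tail G b"
      by (rule inj_onD[OF inj]) (use ab g(2)[OF ab(1)] g(2)[OF ab(2)] in auto)
    moreover have "head G a = head G b"
      by (rule inj_onD[OF inj]) (use ab g(3)[OF ab(1)] g(3)[OF ab(2)] in auto)
    ultimately show "a = b"
      using G.no_multi_arcs[OF ab(1,2)] by (simp add: arc_to_ends_def)
  qed
  moreover have "g ` arcs G = arcs H"
  proof (intro subset_antisym subsetI)
    fix b assume b: "b \<in> arcs H"
    obtain u v where uv: "u \<in> verts G" "f u = tail H b" "v \<in> verts G" "f v = head H b"
      using b im by (metis H.head_in_verts H.tail_in_verts imageE)
    have "f u \<rightarrow>\<^bsub>H\<^esub> f v" unfolding uv arcs_ends_conv using b by auto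
    then have "u \<rightarrow>\<^bsub>G\<^esub> v" using adj uv by simp
    then obtain a where a: "a \<in> arcs G" "tail G a = u" "head G a = v"
      by (auto simp: arcs_ends_conv)
    have "g a = b"
      by (rule H.no_multi_arcs) (use a b g[OF a(1)] uv in \<open>auto simp: arc_to_ends_def\<close>)
    then show "b \<in> g ` arcs G" using a by auto
  qed (use g in auto)
  \<comment> \<open>\<open>digraph_iso\<close> asks for \<open>H\<close> itself as the image record,
    so the new tail and head functions are those of \<open>H\<close>, also off the arcs.\<close>
  ultimately show ?thesis
    unfolding digraph_iso_def
    by (intro exI[of _ "\<lparr>iso_verts = f, iso_arcs = g, iso_head = head H, iso_tail = tail H\<rparr>"])
      (auto simp: G.digraph_isomorphism_def app_iso_def G.wf_digraph_axioms inj im g)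
qed

lemma digraph_isoE_bij:
  assumes "digraph_iso G H"
  obtains f where "bij_betw f (verts G) (verts H)"
    and "\<And>u v. \<lbrakk>u \<in> verts G; v \<in> verts G\<rbrakk> \<Longrightarrow> u \<rightarrow>\<^bsub>G\<^esub> v \<longleftrightarrow> f u \<rightarrow>\<^bsub>H\<^esub> f v"
proof -
  obtain h where h: "pre_digraph.digraph_isomorphism G h" and H: "H = app_iso h G"
    using assms by (auto simp: digraph_iso_def)
  interpret wf_digraph G using h by (simp add: pre_digraph.digraph_isomorphism_def)
  have inj: "inj_on (iso_verts h) (verts G)"
    using h by (simp add: digraph_isomorphism_def)
  show thesis
  proof (rule that)
    show "bij_betw (iso_verts h) (verts G) (verts H)"
      using inj by (simp add: H bij_betw_def)
    fix u v assume "u \<in> verts G" "v \<in> verts G"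
    then show "u \<rightarrow>\<^bsub>G\<^esub> v \<longleftrightarrow> iso_verts h u \<rightarrow>\<^bsub>H\<^esub> iso_verts h v"
      unfolding H arcs_ends_app_iso_eq[OF h]
      by (auto simp: arcs_ends_conv h intro!: rev_image_eqI)
  qed
qed

text \<open>Injectivity and adjacency are controlled on \<open>verts G\<close> only, hence the range
  condition. Quantifiers preserve it, and a bijection preserves the number of witnesses.\<close>

lemma sat_bij:
  fixes p :: "'v fm" and G :: "('a, 'b) pre_digraph"
  assumes bij: "bij_betw f (verts G) (verts H)"
    and adj: "\<And>u v. \<lbrakk>u \<in> verts G; v \<in> verts G\<rbrakk> \<Longrightarrow> u \<rightarrow>\<^bsub>G\<^esub> v \<longleftrightarrow> f u \<rightarrow>\<^bsub>H\<^esub> f v"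
    and "\<And>x. x \<in> free_vars p \<Longrightarrow> s x \<in> verts G"
  shows "sat H (\<lambda>y. f (s y)) p \<longleftrightarrow> sat G s p"
proof -
  have upd: "(\<lambda>y. f ((s(x := v)) y)) = (\<lambda>y. f (s y))(x := f v)" for s :: "'v \<Rightarrow> 'a" and x v
    by auto
  have verts_H: "verts H = f ` verts G" using bij by (simp add: bij_betw_def)
  show ?thesis
    using assms(3)
  proof (induction p arbitrary: s)
    case (Equal x y)
    then show ?case using bij by (auto simp: bij_betw_def dest: inj_onD)
  next
    case (Edge x y)
    then show ?case using adj by simp
  next
    case (Forall x p)
    have "sat H ((\<lambda>y. f (s y))(x := f v)) p \<longleftrightarrow> sat G (s(x := v)) p" if "v \<in> verts G" for v
      by (rule Forall.IH[of "s(x := v)", unfolded upd]) (use Forall.prems that in auto)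
    then show ?case by (auto simp: verts_H)
  next
    case (Exists x p)
    have "sat H ((\<lambda>y. f (s y))(x := f v)) p \<longleftrightarrow> sat G (s(x := v)) p" if "v \<in> verts G" for v
      by (rule Exists.IH[of "s(x := v)", unfolded upd]) (use Exists.prems that in auto)
    then show ?case by (auto simp: verts_H)
  next
    case (ExistsGE i x p)
    have *: "sat H ((\<lambda>y. f (s y))(x := f v)) p \<longleftrightarrow> sat G (s(x := v)) p" if "v \<in> verts G" for v
      by (rule ExistsGE.IH[of "s(x := v)", unfolded upd]) (use ExistsGE.prems that in auto)
    have "{w \<in> verts H. sat H ((\<lambda>y. f (s y))(x := w)) p} = f ` {v \<in> verts G. sat G (s(x := v)) p}"
      using * by (auto simp: verts_H)
    moreover have "inj_on f {v \<in> verts G. sat G (s(x := v)) p}"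
      using bij by (auto simp: bij_betw_def intro: inj_on_subset)
    ultimately show ?case by (simp add: card_image)
  next
    case (Neg p)
    have "sat H (\<lambda>y. f (s y)) p \<longleftrightarrow> sat G s p" by (rule Neg.IH) (use Neg.prems in auto)
    then show ?case by simp
  next
    case (Conj p q)
    have "sat H (\<lambda>y. f (s y)) p \<longleftrightarrow> sat G s p" "sat H (\<lambda>y. f (s y)) q \<longleftrightarrow> sat G s q"
      by (rule Conj.IH; use Conj.prems in auto)+
    then show ?case by simp
  next
    case (Disj p q)
    have "sat H (\<lambda>y. f (s y)) p \<longleftrightarrow> sat G s p" "sat H (\<lambda>y. f (s y)) q \<longleftrightarrow> sat G s q"
      by (rule Disj.IH; use Disj.prems in auto)+
    then show ?case by simp
  next
    case (Impl p q)
    have "sat H (\<lambda>y. f (s y)) p \<longleftrightarrow> sat G s p" "sat H (\<lambda>y. f (s y)) q \<longleftrightarrow> sat G s q"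
      by (rule Impl.IH; use Impl.prems in auto)+
    then show ?case by simp
  next
    case (Equiv p q)
    have "sat H (\<lambda>y. f (s y)) p \<longleftrightarrow> sat G s p" "sat H (\<lambda>y. f (s y)) q \<longleftrightarrow> sat G s q"
      by (rule Equiv.IH; use Equiv.prems in auto)+
    then show ?case by simp
  qed simp
qed

section \<open>Isomorphism invariance of sentences\<close>

lemma sat_sentence:
  assumes "free_vars p = {}"
  shows "sat G s p \<longleftrightarrow> models G p"
  unfolding models_def using assms sat_cong[of p s _ G] by auto

lemma digraph_iso_imp_C_equivalent:
  assumes "digraph_iso G H"
  shows "C_equivalent k G H"
proof -
  obtain f where bij: "bij_betw f (verts G) (verts H)"
    and adj: "\<And>u v. \<lbrakk>u \<in> verts G; v \<in> verts G\<rbrakk> \<Longrightarrow> u \<rightarrow>\<^bsub>G\<^esub> v \<longleftrightarrow> f u \<rightarrow>\<^bsub>H\<^esub> f v"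
    using assms by (rule digraph_isoE_bij) blast
  show ?thesis
    unfolding C_equivalent_def
  proof
    fix p assume "p \<in> C_sentences k"
    then have p: "free_vars p = {}" by (simp add: C_sentences_def)
    \<comment> \<open>A sentence has no free variables, so the range condition of
      \<open>sat_bij\<close> is vacuous.\<close>
    have "sat H (\<lambda>x. f (s x)) p \<longleftrightarrow> sat G s p" for s
      using bij adj by (rule sat_bij) (use p in auto)
    then show "models G p \<longleftrightarrow> models H p" using sat_sentence[OF p] by metis
  qed
qed

section \<open>Walk counts in two-variable counting logic\<close>

text \<open>Natural-number version of \<open>num_walks\<close>: formulas compare it with
  cardinalities, linear algebra works with the real one.\<close>

fun walk_count :: "('a, 'b) pre_digraph \<Rightarrow> nat \<Rightarrow> 'a \<Rightarrow> nat" where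
  "walk_count G 0 x = 1"
| "walk_count G (Suc k) x = (\<Sum>y | y \<in> verts G \<and> x \<rightarrow>\<^bsub>G\<^esub> y. walk_count G k y)"

lemma num_walks_eq_walk_count:
  assumes "finite (verts G)"
  shows "num_walks G k x = real (walk_count G k x)"
proof (induction k arbitrary: x)
  case (Suc k)
  have "num_walks G (Suc k) x
    = (\<Sum>y\<in>verts G. if x \<rightarrow>\<^bsub>G\<^esub> y then real (walk_count G k y) else 0)"
    by (auto simp: Suc intro!: sum.cong)
  also have "\<dots> = (\<Sum>y | y \<in> verts G \<and> x \<rightarrow>\<^bsub>G\<^esub> y. real (walk_count G k y))"
    using sum.inter_filter[OF assms] by (rule sym)
  finally show ?case by simp
qed simp

text \<open>At most \<open>N\<close> neighbours contribute at most \<open>N ^ k\<close> each. The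
  bound leaves finitely many values for a formula to distinguish.\<close>

lemma walk_count_le:
  assumes "finite (verts G)" "card (verts G) \<le> N"
  shows "walk_count G k x \<le> N ^ k"
proof (induction k arbitrary: x)
  case (Suc k)
  have "walk_count G (Suc k) x \<le> card {y. y \<in> verts G \<and> x \<rightarrow>\<^bsub>G\<^esub> y} * N ^ k"
    using sum_bounded_above[OF Suc] by simp
  also have "card {y. y \<in> verts G \<and> x \<rightarrow>\<^bsub>G\<^esub> y} \<le> N"
    using card_mono[OF assms(1), of "{y. y \<in> verts G \<and> x \<rightarrow>\<^bsub>G\<^esub> y}"] assms(2) by auto
  finally show ?case by simp
qed simp

section \<open>Formulas for walk counts\<close>

definition Truth :: "'v fm" where
  "Truth = Neg Falsum"

text \<open>\<open>positive_counts\<close> forbids the threshold 0, so that trivial case becomes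
  \<open>Truth\<close>.\<close>

definition at_least :: "nat \<Rightarrow> 'v \<Rightarrow> 'v fm \<Rightarrow> 'v fm" where
  "at_least i v p = (if i = 0 then Truth else ExistsGE i v p)"

definition exactly :: "nat \<Rightarrow> 'v \<Rightarrow> 'v fm \<Rightarrow> 'v fm" where
  "exactly i v p = Conj (at_least i v p) (Neg (at_least (Suc i) v p))"

definition disj_list :: "'v fm list \<Rightarrow> 'v fm" where
  "disj_list ps = foldr Disj ps Falsum"

definition conj_list :: "'v fm list \<Rightarrow> 'v fm" where
  "conj_list ps = foldr Conj ps Truth"

text \<open>
  If \<open>q j\<close> says that the value at \<open>u\<close> is \<open>j\<close>, then \<open>weighted_fm q v u m c\<close> says that the values up to
  \<open>m\<close> at the neighbours \<open>u\<close> of \<open>v\<close> add up to \<open>c\<close>.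
\<close>

fun weighted_fm :: "(nat \<Rightarrow> 'v fm) \<Rightarrow> 'v \<Rightarrow> 'v \<Rightarrow> nat \<Rightarrow> nat \<Rightarrow> 'v fm" where
  "weighted_fm q v u 0 c = (if c = 0 then Truth else Falsum)"
| "weighted_fm q v u (Suc m) c = disj_list
     (map (\<lambda>i. Conj (exactly i u (Conj (Edge v u) (q (Suc m)))) (weighted_fm q v u m (c - Suc m * i)))
       (filter (\<lambda>i. Suc m * i \<le> c) [0..<Suc c]))"

text \<open>
  \<open>walk_fm N k v u c\<close> says that there are \<open>c\<close> walks of length \<open>k\<close> from \<open>v\<close>, in graphs with at most
  \<open>N\<close> vertices, where \<open>N ^ k\<close> is a bound for the number of these walks.
\<close>

fun walk_fm :: "nat \<Rightarrow> nat \<Rightarrow> 'v \<Rightarrow> 'v \<Rightarrow> nat \<Rightarrow> 'v fm" where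
  "walk_fm N 0 v u c = (if c = 1 then Truth else Falsum)"
| "walk_fm N (Suc k) v u c = weighted_fm (walk_fm N k u v) v u (N ^ k) c"

section \<open>Semantics and variables of the formulas\<close>

lemma sat_Truth [simp]: "sat G s Truth"
  and fm_vars_Truth [simp]: "fm_vars Truth = {}"
  and free_vars_Truth [simp]: "free_vars Truth = {}"
  and positive_counts_Truth [simp]: "positive_counts Truth"
  by (simp_all add: Truth_def)

lemma sat_exactly [simp]:
  "sat G s (exactly i v p) \<longleftrightarrow> card {x \<in> verts G. sat G (s(v := x)) p} = i"
  by (auto simp: exactly_def at_least_def)

lemma fm_vars_exactly: "fm_vars (exactly i v p) = insert v (fm_vars p)"
  and free_vars_exactly: "free_vars (exactly i v p) = free_vars p - {v}"
  and positive_counts_exactly: "positive_counts (exactly i v p) = positive_counts p"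
  by (auto simp: exactly_def at_least_def)

lemma sat_disj_list [simp]: "sat G s (disj_list ps) \<longleftrightarrow> (\<exists>p\<in>set ps. sat G s p)"
  and fm_vars_disj_list: "fm_vars (disj_list ps) = (\<Union>p\<in>set ps. fm_vars p)"
  and free_vars_disj_list: "free_vars (disj_list ps) = (\<Union>p\<in>set ps. free_vars p)"
  and positive_counts_disj_list: "positive_counts (disj_list ps) = (\<forall>p\<in>set ps. positive_counts p)"
  by (induction ps) (auto simp: disj_list_def)

lemma sat_conj_list [simp]: "sat G s (conj_list ps) \<longleftrightarrow> (\<forall>p\<in>set ps. sat G s p)"
  and fm_vars_conj_list: "fm_vars (conj_list ps) = (\<Union>p\<in>set ps. fm_vars p)"
  and free_vars_conj_list: "free_vars (conj_list ps) = (\<Union>p\<in>set ps. free_vars p)"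
  and positive_counts_conj_list: "positive_counts (conj_list ps) = (\<forall>p\<in>set ps. positive_counts p)"
  by (induction ps) (auto simp: conj_list_def)

text \<open>If \<open>i\<close> neighbours have the top value \<open>Suc m\<close>, the smaller
  values must add up to the rest. The value 0 contributes nothing, so the sum starts at 1.\<close>

lemma sat_weighted_fm:
  assumes "v \<noteq> u"
  shows "sat G s (weighted_fm q v u m c) \<longleftrightarrow>
    (\<Sum>j = 1..m. j * card {y \<in> verts G. s v \<rightarrow>\<^bsub>G\<^esub> y \<and> sat G (s(u := y)) (q j)}) = c"
proof (induction m arbitrary: c)
  case (Suc m)
  define S where "S = (\<Sum>j = 1..m. j * card {y \<in> verts G. s v \<rightarrow>\<^bsub>G\<^esub> y \<and> sat G (s(u := y)) (q j)})"
  define i where "i = card {y \<in> verts G. s v \<rightarrow>\<^bsub>G\<^esub> y \<and> sat G (s(u := y)) (q (Suc m))}"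
  have "sat G s (weighted_fm q v u m d) \<longleftrightarrow> S = d" for d
    unfolding S_def by (rule Suc)
  \<comment> \<open>Re-quantifying \<open>u\<close> leaves the vertex at \<open>v\<close> in place
    because \<open>v\<close> and \<open>u\<close> differ.\<close>
  moreover have "sat G s (exactly l u (Conj (Edge v u) (q (Suc m)))) \<longleftrightarrow> i = l" for l
    unfolding i_def using assms by simp
  ultimately have "sat G s (weighted_fm q v u (Suc m) c) \<longleftrightarrow>
      i < Suc c \<and> Suc m * i \<le> c \<and> S = c - Suc m * i"
    by (auto simp del: sat_exactly mult_Suc upt_Suc)
  \<comment> \<open>The filter condition makes the truncated subtraction exact, and it implies
    \<open>i < Suc c\<close>.\<close>
  also have "\<dots> \<longleftrightarrow> S + Suc m * i = c"
    by auto
  finally show ?case by (simp add: S_def i_def del: weighted_fm.simps fun_upd_apply)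
qed auto

lemma fm_vars_weighted_fm:
  assumes "\<And>j. fm_vars (q j) \<subseteq> {v, u}"
  shows "fm_vars (weighted_fm q v u m c) \<subseteq> {v, u}"
proof (induction m arbitrary: c)
  case (Suc m)
  then show ?case
    by (auto simp: fm_vars_disj_list fm_vars_exactly dest!: subsetD[OF Suc] subsetD[OF assms])
qed simp

text \<open>\<open>exactly\<close> binds \<open>u\<close>, and only the edge atom mentions
  \<open>v\<close> freely.\<close>

lemma free_vars_weighted_fm:
  assumes "\<And>j. free_vars (q j) \<subseteq> {u}"
  shows "free_vars (weighted_fm q v u m c) \<subseteq> {v}"
proof (induction m arbitrary: c)
  case (Suc m)
  then show ?case
    by (auto simp: free_vars_disj_list free_vars_exactly dest!: subsetD[OF Suc] subsetD[OF assms])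
qed simp

lemma positive_counts_weighted_fm:
  assumes "\<And>j. positive_counts (q j)"
  shows "positive_counts (weighted_fm q v u m c)"
  using assms
  by (induction m arbitrary: c) (auto simp: positive_counts_disj_list positive_counts_exactly)

text \<open>The two variables swap roles at each step of the walk, so no third one ever
  enters.\<close>

lemma fm_vars_walk_fm: "fm_vars (walk_fm N k v u c) \<subseteq> {v, u}"
proof (induction k arbitrary: v u c)
  case (Suc k)
  have "fm_vars (walk_fm N k u v j) \<subseteq> {v, u}" for j
    using Suc[of u v j] by auto
  then show ?case by (simp add: fm_vars_weighted_fm)
qed simp

lemma free_vars_walk_fm: "free_vars (walk_fm N k v u c) \<subseteq> {v}"
  by (induction k arbitrary: v u c) (simp_all add: free_vars_weighted_fm)

lemma positive_counts_walk_fm: "positive_counts (walk_fm N k v u c)"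
  by (induction k arbitrary: v u c) (simp_all add: positive_counts_weighted_fm)

lemma sum_eq_sum_card_levels:
  fixes f :: "'a \<Rightarrow> nat"
  assumes "finite A" "\<And>x. x \<in> A \<Longrightarrow> f x \<le> m"
  shows "(\<Sum>x\<in>A. f x) = (\<Sum>j = 1..m. j * card {x \<in> A. f x = j})"
proof -
  have "(\<Sum>x\<in>A. f x) = (\<Sum>j\<in>{0..m}. \<Sum>x | x \<in> A \<and> f x = j. f x)"
    by (rule sum.group[symmetric]) (use assms in auto)
  also have "\<dots> = (\<Sum>j\<in>{0..m}. j * card {x \<in> A. f x = j})"
    by (intro sum.cong) auto
  also have "\<dots> = (\<Sum>j = 1..m. j * card {x \<in> A. f x = j})"
    by (rule sum.mono_neutral_right) auto
  finally show ?thesis .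
qed

text \<open>The induction ranges over assignments and variables, since the formula for the remaining
  walk is read at the neighbour assigned to \<open>u\<close>, with \<open>u\<close> and
  \<open>v\<close> exchanged.\<close>

lemma sat_walk_fm:
  assumes "finite (verts G)" "card (verts G) \<le> N" "v \<noteq> u"
  shows "sat G s (walk_fm N k v u c) \<longleftrightarrow> walk_count G k (s v) = c"
  using assms(3)
proof (induction k arbitrary: s v u c)
  case (Suc k)
  have "sat G s (walk_fm N (Suc k) v u c) \<longleftrightarrow>
    (\<Sum>j = 1..N ^ k. j * card {y \<in> {y. y \<in> verts G \<and> s v \<rightarrow>\<^bsub>G\<^esub> y}. walk_count G k y = j}) = c"
    using Suc by (simp add: sat_weighted_fm conj_assoc)
  also have "\<dots> \<longleftrightarrow> walk_count G (Suc k) (s v) = c"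
    by (subst sum_eq_sum_card_levels[symmetric])
      (use assms(1) walk_count_le[OF assms(1,2)] in auto)
  finally show ?case .
qed auto

lemma C_equivalent_walk_counts:
  assumes "C_equivalent 2 G H" "finite (verts G)" "finite (verts H)" "x \<in> verts G"
  obtains y where "y \<in> verts H" "\<And>k. k \<le> K \<Longrightarrow> walk_count H k y = walk_count G k x"
proof -
  \<comment> \<open>One sentence is evaluated in both graphs, so \<open>N\<close> must bound both
    orders.\<close>
  define N where "N = max (card (verts G)) (card (verts H))"
  define p :: "nat fm" where
    "p = Exists 0 (conj_list (map (\<lambda>k. walk_fm N k 0 1 (walk_count G k x)) [0..<Suc K]))"
  have "fm_vars p \<subseteq> {0, 1}"
    unfolding p_def using fm_vars_walk_fm[of N _ "0 :: nat" 1]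
    by (auto simp: fm_vars_conj_list simp del: upt_Suc)
  from card_mono[OF _ this] have card: "card (fm_vars p) \<le> 2" by simp
  have free: "free_vars p = {}"
    unfolding p_def using free_vars_walk_fm[of N _ "0 :: nat" 1]
    by (auto simp: free_vars_conj_list simp del: upt_Suc)
  have pos: "positive_counts p"
    by (auto simp: p_def positive_counts_conj_list positive_counts_walk_fm)
  have "sat G s p" for s
    using assms(2,4)
    by (auto simp: p_def sat_walk_fm N_def simp del: upt_Suc intro!: bexI[of _ x])
  then have "models G p" by (simp add: models_def)
  moreover have "p \<in> C_sentences 2"
    using card free pos by (simp add: C_sentences_def)
  ultimately have "sat H s p" for s
    using assms(1) by (simp add: C_equivalent_def models_def)
  then obtain y where "y \<in> verts H" "\<forall>k<Suc K. walk_count H k y = walk_count G k x"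
    using assms(3) by (auto simp: p_def sat_walk_fm N_def simp del: upt_Suc)
  then show thesis by (intro that[of y]) auto
qed

section \<open>Controllable graphs\<close>

text \<open>The weights form a vector annihilated by the transposed walk matrix, whose determinant
  is nonzero.\<close>

lemma controllable_weights_zero:
  assumes "controllable G"
    and zero: "\<And>k. k < card (verts G) \<Longrightarrow> (\<Sum>y\<in>verts G. c y * num_walks G k y) = 0"
    and "x \<in> verts G"
  shows "c x = 0"
proof -
  obtain vs where vs: "distinct vs" "set vs = verts G" and inv: "invertible_mat (walk_mat G vs)"
    using assms(1) by (auto simp: controllable_def)
  let ?n = "length vs" and ?W = "walk_mat G vs"
  have n: "card (verts G) = ?n" using vs distinct_card by metis
  have W: "?W \<in> carrier_mat ?n ?n" by (simp add: walk_mat_eq[OF vs])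
  have bij: "bij_betw ((!) vs) {0..<?n} (verts G)"
    using vs bij_betw_nth[of vs "{0..<?n}" "verts G"] by (simp add: atLeast0LessThan)
  define v where "v = vec ?n (\<lambda>i. c (vs ! i))"
  have "transpose_mat ?W *\<^sub>v v = 0\<^sub>v ?n"
  proof (rule eq_vecI)
    fix k assume "k < dim_vec (0\<^sub>v ?n)"
    then have k: "k < ?n" by simp
    have "(transpose_mat ?W *\<^sub>v v) $ k = (\<Sum>i = 0..<?n. c (vs ! i) * num_walks G k (vs ! i))"
      using k by (simp add: walk_mat_eq[OF vs] scalar_prod_def v_def mult.commute)
    also have "\<dots> = (\<Sum>y\<in>verts G. c y * num_walks G k y)"
      by (rule sum.reindex_bij_betw[OF bij])
    finally show "(transpose_mat ?W *\<^sub>v v) $ k = 0\<^sub>v ?n $ k" using zero k n by simp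
  qed (simp add: walk_mat_eq[OF vs])
  moreover have "det (transpose_mat ?W) \<noteq> 0"
    using inv invertible_mat_iff_det[OF W] det_transpose[OF W] by simp
  moreover have "v \<in> carrier_vec ?n" by (simp add: v_def)
  ultimately have "v = 0\<^sub>v ?n"
    using det_0_iff_vec_prod_zero_field[of "transpose_mat ?W" ?n] W by auto
  moreover obtain i where "i < ?n" "x = vs ! i"
    using assms(3) vs(2) by (metis in_set_conv_nth)
  ultimately show ?thesis by (metis index_vec index_zero_vec(1) v_def)
qed

lemma controllable_walk_counts_inj:
  assumes "controllable G" "finite (verts G)" "x \<in> verts G" "y \<in> verts G"
    and "\<And>k. k < card (verts G) \<Longrightarrow> walk_count G k x = walk_count G k y"
  shows "x = y"
proof (rule ccontr)
  assume "x \<noteq> y"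
  \<comment> \<open>The difference of two point indicators is orthogonal to every column in which
    the rows of \<open>x\<close> and \<open>y\<close> agree.\<close>
  define c :: "'a \<Rightarrow> real" where "c z = of_bool (z = x) - of_bool (z = y)" for z
  have sum_c: "(\<Sum>z\<in>verts G. c z * num_walks G k z) = num_walks G k x - num_walks G k y" for k
    using assms(2-4)
    by (simp add: c_def left_diff_distrib sum_subtractf of_bool_def if_distrib[of "\<lambda>b. b * _"]
        cong: if_cong)
  have "c x = 0"
    by (rule controllable_weights_zero[OF assms(1) _ assms(3), of c])
      (unfold sum_c, simp add: num_walks_eq_walk_count[OF assms(2)] assms(5))
  then show False using \<open>x \<noteq> y\<close> by (simp add: c_def)
qed

section \<open>Reconstructing the isomorphism\<close>

lemma walk_count_map_inj_on:
  assumes "controllable G" "finite (verts G)"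
    and "\<And>x k. \<lbrakk>x \<in> verts G; k < card (verts G)\<rbrakk> \<Longrightarrow> walk_count H k (f x) = walk_count G k x"
  shows "inj_on f (verts G)"
proof (rule inj_onI)
  fix x y assume "x \<in> verts G" "y \<in> verts G" "f x = f y"
  then show "x = y"
    using assms(3)[of x] assms(3)[of y] by (intro controllable_walk_counts_inj[OF assms(1,2)]) auto
qed

lemma C2_equivalent_imp_digraph_iso:
  assumes "nomulti_digraph G" "nomulti_digraph H" "controllable G" "controllable H"
    and fin: "finite (verts G)" "finite (verts H)"
    and equiv: "C_equivalent 2 G H"
  shows "digraph_iso G H"
proof -
  \<comment> \<open>The rows must agree one length past the last column of the walk matrix of
    \<open>G\<close>, because the adjacency matrix lengthens walks by one.\<close>
  define N where "N = max (card (verts G)) (card (verts H))"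
  have "\<exists>y\<in>verts H. \<forall>k\<le>N. walk_count H k y = walk_count G k x" if "x \<in> verts G" for x
    using C_equivalent_walk_counts[OF equiv fin that, of N] by metis
  then obtain f where f: "\<And>x. x \<in> verts G \<Longrightarrow> f x \<in> verts H"
      "\<And>x k. \<lbrakk>x \<in> verts G; k \<le> N\<rbrakk> \<Longrightarrow> walk_count H k (f x) = walk_count G k x"
    by metis
  have "C_equivalent 2 H G" using equiv by (simp add: C_equivalent_def)
  then have "\<exists>x\<in>verts G. \<forall>k\<le>N. walk_count G k x = walk_count H k y" if "y \<in> verts H" for y
    using C_equivalent_walk_counts[OF _ fin(2,1) that, of N] by metis
  then obtain g where g: "\<And>y. y \<in> verts H \<Longrightarrow> g y \<in> verts G"
      "\<And>y k. \<lbrakk>y \<in> verts H; k \<le> N\<rbrakk> \<Longrightarrow> walk_count G k (g y) = walk_count H k y"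
    by metis
  have inj: "inj_on f (verts G)"
    by (rule walk_count_map_inj_on[OF assms(3) fin(1), of H]) (use f in \<open>auto simp: N_def\<close>)
  have "inj_on g (verts H)"
    by (rule walk_count_map_inj_on[OF assms(4) fin(2), of G]) (use g in \<open>auto simp: N_def\<close>)
  \<comment> \<open>The injection \<open>g\<close> serves to compare cardinalities, which turns the
    injective \<open>f\<close> into a bijection.\<close>
  then have "card (verts H) \<le> card (verts G)"
    using g(1) fin(1) by (intro card_inj_on_le[of g]) auto
  then have "f ` verts G = verts H"
    using f(1) fin(2) inj by (intro card_seteq) (auto simp: card_image)
  then have bij: "bij_betw f (verts G) (verts H)" using inj by (simp add: bij_betw_def)
  have "u \<rightarrow>\<^bsub>G\<^esub> v \<longleftrightarrow> f u \<rightarrow>\<^bsub>H\<^esub> f v" if "u \<in> verts G" "v \<in> verts G" for u v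
  proof -
    \<comment> \<open>Row \<open>u\<close> of the adjacency matrix of \<open>G\<close> minus row
      \<open>f u\<close> of that of \<open>H\<close>, pulled back along \<open>f\<close>.\<close>
    define c :: "'a \<Rightarrow> real" where
      "c y = (if u \<rightarrow>\<^bsub>G\<^esub> y then 1 else 0) - (if f u \<rightarrow>\<^bsub>H\<^esub> f y then 1 else 0)" for y
    have "(\<Sum>y\<in>verts G. c y * num_walks G k y) = 0" if k: "k < card (verts G)" for k
    proof -
      have kN: "k \<le> N" "Suc k \<le> N" using k by (auto simp: N_def)
      have "(\<Sum>y\<in>verts G. (if f u \<rightarrow>\<^bsub>H\<^esub> f y then 1 else 0) * num_walks G k y)
        = (\<Sum>y\<in>verts G. (if f u \<rightarrow>\<^bsub>H\<^esub> f y then 1 else 0) * num_walks H k (f y))"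
        using f(2) kN(1) fin by (intro sum.cong) (auto simp: num_walks_eq_walk_count)
      also have "\<dots> = num_walks H (Suc k) (f u)"
        using sum.reindex_bij_betw[OF bij,
            of "\<lambda>y. (if f u \<rightarrow>\<^bsub>H\<^esub> y then 1 else 0) * num_walks H k y"]
        by simp
      also have "\<dots> = num_walks G (Suc k) u"
        using f(2)[OF \<open>u \<in> verts G\<close> kN(2)] fin
        by (simp only: num_walks_eq_walk_count)
      finally show ?thesis by (simp add: c_def left_diff_distrib sum_subtractf)
    qed
    then have "c v = 0"
      by (rule controllable_weights_zero[OF assms(3) _ \<open>v \<in> verts G\<close>])
    then show ?thesis by (simp add: c_def split: if_splits)
  qed
  with assms(1,2) bij show ?thesis by (rule digraph_isoI_bij)
qed

theorem theorem3p2: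
  fixes \<Gamma> :: "('a, 'b) pre_digraph" and \<Delta> :: "('c, 'd) pre_digraph"
  assumes "graph \<Gamma>" and "graph \<Delta>"
    and "controllable \<Gamma>" and "controllable \<Delta>"
  shows "digraph_iso \<Gamma> \<Delta> \<longleftrightarrow> C_equivalent 2 \<Gamma> \<Delta>"
proof
  interpret G: graph \<Gamma> by fact
  interpret D: graph \<Delta> by fact
  show "digraph_iso \<Gamma> \<Delta>" if "C_equivalent 2 \<Gamma> \<Delta>"
    using C2_equivalent_imp_digraph_iso[OF G.nomulti_digraph D.nomulti_digraph assms(3,4)
        G.finite_verts D.finite_verts that] .
qed (rule digraph_iso_imp_C_equivalent)

end
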